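(* Let $G$ be an infinite group of cardinality $\varkappa$ which is Abelian or, more generally, which has an Abelian homomorphic image of cardinality $\varkappa$ (in particular, $G$ may be a free group of rank $\varkappa$). Then there exists a partition $G=\bigcup_{n<\omega}A_n$ of $G$ into countably many cells such that $cov(A_nA_n^{-1})=\varkappa$ for each $n\in\omega$.
   Context: For a group $G$ and a (nonempty) subset $A\subseteq G$, $cov(A)=\min\{|X| : X\subseteq G,\ G=XA\}$, where $XA=\{xa : x\in X,\ a\in A\}$; also $AA^{-1}=\{ab^{-1} : a,b\in A\}$. $\omega=\{0,1,2,\dots\}$. A partition $G=\bigcup_{n<\omega}A_n$ means that the cells $A_n$ are nonempty, pairwise disjoint, and have union $G$. *)

theory Defs
  imports "HOL-Algebra.Coset" "HOL-Library.Disjoint_Sets"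
begin

unbundle cardinal_syntax

text \<open>As in the BNF cardinal library, a cardinal is a well-order, compared up to \<open>=o\<close> and
  \<open>\<le>o\<close>. The covering number of \<open>A\<close> is the cardinality of some covering set \<open>X\<close> of least
  cardinality; such an \<open>X\<close> exists for every nonempty \<open>A\<close>, and the value is independent of the
  choice up to \<open>=o\<close> (lemmas \<open>cov_attained\<close> and \<open>cov_le\<close>).\<close>

definition covers :: "('a, 'm) monoid_scheme \<Rightarrow> 'a set \<Rightarrow> 'a set \<Rightarrow> bool" where
  "covers G A X \<longleftrightarrow> X \<subseteq> carrier G \<and> carrier G = X <#>\<^bsub>G\<^esub> A"

definition cov :: "('a, 'm) monoid_scheme \<Rightarrow> 'a set \<Rightarrow> 'a rel" where
  "cov G A = |SOME X. covers G A X \<and> (\<forall>Y. covers G A Y \<longrightarrow> |X| \<le>o |Y| )|"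

lemma covers_carrier:
  assumes "group G" "A \<subseteq> carrier G" "A \<noteq> {}"
  shows "covers G A (carrier G)"
proof -
  interpret group G by fact
  obtain a where a: "a \<in> A" "a \<in> carrier G" using assms by blast
  have "x \<in> carrier G <#>\<^bsub>G\<^esub> A" if "x \<in> carrier G" for x
  proof -
    have "x = (x \<otimes>\<^bsub>G\<^esub> inv\<^bsub>G\<^esub> a) \<otimes>\<^bsub>G\<^esub> a" using a that by (simp add: m_assoc)
    then show ?thesis using a that unfolding set_mult_def by blast
  qed
  then show ?thesis using assms(2) unfolding covers_def set_mult_def by auto
qed

lemma cov_witness:
  assumes "covers G A X0"
  shows "\<exists>X. covers G A X \<and> (\<forall>Y. covers G A Y \<longrightarrow> |X| \<le>o |Y| )"
proof -
  let ?R = "card_of ` {X. covers G A X}"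
  have "\<exists>r\<in>?R. \<forall>r'\<in>?R. r \<le>o r'"
    by (rule exists_minim_Well_order) (use assms card_of_Well_order in auto)
  then show ?thesis by auto
qed

lemma cov_attained:
  assumes "group G" "A \<subseteq> carrier G" "A \<noteq> {}"
  shows "\<exists>X. covers G A X \<and> cov G A = |X|"
  unfolding cov_def using someI_ex[OF cov_witness[OF covers_carrier[OF assms]]] by blast

lemma cov_le:
  assumes "covers G A Y"
  shows "cov G A \<le>o |Y|"
  unfolding cov_def using someI_ex[OF cov_witness[OF assms]] assms by blast

text \<open>A letter \<open>(s, True)\<close> stands for \<open>s\<close> and \<open>(s, False)\<close> for the inverse of \<open>s\<close>. A word is
  reduced if no letter is followed by its formal inverse, and \<open>G\<close> is free with basis \<open>S\<close> if every
  element of \<open>G\<close> is the value of exactly one reduced word over \<open>S\<close>.\<close>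

definition reduced_word :: "('a \<times> bool) list \<Rightarrow> bool" where
  "reduced_word w \<longleftrightarrow> successively (\<lambda>p q. \<not> (fst p = fst q \<and> snd p \<noteq> snd q)) w"

primrec word_value :: "('a, 'm) monoid_scheme \<Rightarrow> ('a \<times> bool) list \<Rightarrow> 'a" where
  "word_value G [] = \<one>\<^bsub>G\<^esub>"
| "word_value G (p # w) = (if snd p then fst p else inv\<^bsub>G\<^esub> (fst p)) \<otimes>\<^bsub>G\<^esub> word_value G w"

definition free_basis :: "('a, 'm) monoid_scheme \<Rightarrow> 'a set \<Rightarrow> bool" where
  "free_basis G S \<longleftrightarrow> S \<subseteq> carrier G \<and>
     (\<forall>g\<in>carrier G. \<exists>!w. fst ` set w \<subseteq> S \<and> reduced_word w \<and> word_value G w = g)"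

end

theory Submission
  imports Defs Complex_Main "HOL-Algebra.Free_Abelian_Groups"
begin

text \<open>If \<open>G\<close> is countable, its singletons form the required partition, since then
  \<open>A A\<^sup>-\<^sup>1\<close> is the trivial group. So let \<open>\<kappa>\<close> be the cardinality of \<open>G\<close> and suppose it
  uncountable.

  The cells are the level sets of a length function. Suppose that there is a homomorphism \<open>\<chi>\<close> from
  \<open>G\<close> into a direct sum of copies of the group of complex roots of unity in which \<open>\<kappa>\<close> coordinates
  are hit. Let the length of \<open>g\<close> be the number of nontrivial coordinates of \<open>\<chi> g\<close>. If
  \<open>A\<close> consists of elements of length \<open>n\<close>, then the elements of \<open>A A\<^sup>-\<^sup>1\<close> have length at
  most \<open>2 n\<close>. A set \<open>X\<close> with fewer than \<open>\<kappa>\<close> elements involves a set \<open>Y\<close> of fewer than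
  \<open>\<kappa>\<close> coordinates. Some \<open>g\<close> is trivial on \<open>Y\<close> and has length greater than \<open>2 n\<close>
  (\<open>ex_large_supp_disjoint\<close>). If \<open>g = x b\<close> with \<open>x \<in> X\<close>, then \<open>b\<close> agrees with \<open>g\<close>
  outside \<open>Y\<close>, so \<open>b\<close> is too long to lie in \<open>A A\<^sup>-\<^sup>1\<close>. Hence \<open>X\<close> is not a covering
  set (\<open>cover_of_bounded_supp\<close>). That \<open>g\<close> exists is a counting argument: the group of roots of
  unity is countable, so restricting \<open>\<chi>\<close> to \<open>Y\<close> produces fewer than \<open>\<kappa>\<close> values
  (\<open>ex_supp_disjoint\<close>).

  It remains to find \<open>\<chi>\<close>. In a free group, the parities of the exponent sums of the basis
  elements will do (\<open>ex_char_family_free\<close>). In an Abelian group, \<open>\<chi>\<close> comes from Zorn's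
  lemma (\<open>ex_char_family_generate\<close>). A partial homomorphism with domain \<open>K\<close> extends to any
  \<open>g \<notin> K\<close>: its old coordinates extend because the group of roots of unity is divisible, and there is
  room for a new coordinate, labelled \<open>g\<close>, which is trivial on \<open>K\<close> and nontrivial at
  \<open>g\<close>. The labels used in this way generate \<open>G\<close>, so there are \<open>\<kappa>\<close> of them. For a group with a
  large Abelian image, \<open>\<chi>\<close> is pulled back from the image.\<close>

section \<open>Roots of unity\<close>

definition unity_roots :: "complex set" where
  "unity_roots = {z. \<exists>n>0. z ^ n = 1}"

lemma one_unity_root [simp]: "1 \<in> unity_roots"
  unfolding unity_roots_def by auto

lemma unity_root_neq_0: "z \<in> unity_roots \<Longrightarrow> z \<noteq> 0"
  unfolding unity_roots_def by (auto simp: power_0_left)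

lemma unity_root_mult:
  assumes "y \<in> unity_roots" "z \<in> unity_roots"
  shows "y * z \<in> unity_roots"
proof -
  obtain m n where mn: "m > 0" "y ^ m = 1" "n > 0" "z ^ n = 1"
    using assms unfolding unity_roots_def by auto
  have "y ^ (m * n) = 1" using mn by (simp add: power_mult)
  moreover have "z ^ (m * n) = 1" using mn by (simp only: mult.commute[of m n] power_mult power_one)
  ultimately have "m * n > 0 \<and> (y * z) ^ (m * n) = 1" using mn by (simp add: power_mult_distrib)
  then show ?thesis unfolding unity_roots_def by blast
qed

lemma unity_root_inverse: "z \<in> unity_roots \<Longrightarrow> inverse z \<in> unity_roots"
  unfolding unity_roots_def by (auto simp: power_inverse)

lemma unity_root_powi: "z \<in> unity_roots \<Longrightarrow> z powi k \<in> unity_roots"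
proof -
  assume z: "z \<in> unity_roots"
  have "z ^ n \<in> unity_roots" for n
    by (induction n) (auto simp: z unity_root_mult)
  then show ?thesis by (simp add: power_int_def unity_root_inverse power_inverse)
qed

lemma countable_unity_roots: "countable unity_roots"
proof -
  have "unity_roots = (\<Union>n\<in>{0<..}. {z. z ^ n = 1})"
    unfolding unity_roots_def by auto
  also have "countable \<dots>"
    using finite_roots_unity by (intro countable_UN countableI_type countable_finite) (auto simp: Suc_le_eq)
  finally show ?thesis .
qed

lemma unity_root_divisible:
  assumes "z \<in> unity_roots" "n > 0"
  shows "\<exists>y\<in>unity_roots. y ^ n = z"
proof -
  obtain m where m: "m > 0" "z ^ m = 1" using assms unfolding unity_roots_def by auto
  then have "norm z ^ m = 1" by (simp flip: norm_power)
  then have "norm z = 1" using m(1) power_eq_imp_eq_base[of "norm z" m 1] by simp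
  then have z: "z = cis (Arg z)" by (metis rcis_cmod_Arg rcis_def of_real_1 mult_1)
  define y where "y = cis (Arg z / n)"
  have y: "y ^ n = z" using z assms(2) by (simp add: y_def Complex.DeMoivre)
  then have "y ^ (n * m) = 1" using m by (simp add: power_mult)
  moreover have "n * m > 0" using assms(2) m by simp
  ultimately have "y \<in> unity_roots" unfolding unity_roots_def by blast
  then show ?thesis using y by blast
qed

text \<open>The case \<open>n = 0\<close> is used for elements none of whose nontrivial powers lies in a given
  subgroup: any nontrivial root of unity may then be the value of a new character.\<close>

lemma nontrivial_unity_root:
  assumes "n \<noteq> (1::nat)"
  shows "\<exists>y\<in>unity_roots. y \<noteq> 1 \<and> y ^ n = 1"
proof (cases "n = 0")
  case True
  have "(-1::complex) \<in> unity_roots" unfolding unity_roots_def by (auto intro!: exI[of _ 2])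
  then show ?thesis using True by (intro bexI[of _ "-1"]) auto
next
  case False
  then have n: "n > 1" using assms by simp
  have "card {z::complex. z ^ n = 1} = n" using n by (intro card_roots_unity_eq) simp
  then have "\<not> {z::complex. z ^ n = 1} \<subseteq> {1}"
    using n by (metis card_mono finite.emptyI finite_insert is_singletonI is_singleton_altdef leD)
  then obtain y :: complex where y: "y ^ n = 1" "y \<noteq> 1" by auto
  moreover from y n have "y \<in> unity_roots" unfolding unity_roots_def by (intro CollectI exI[of _ n]) simp
  ultimately show ?thesis by blast
qed

section \<open>Partitions from finitely supported families of characters\<close>

lemma uncountable_nat_ordLess:
  assumes "uncountable A"
  shows "|UNIV::nat set| <o |A|"
proof -
  have "\<not> |A| \<le>o |UNIV::nat set|"
    using assms card_of_ordLeq[of A "UNIV::nat set"] unfolding countable_def by blast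
  then show ?thesis by simp
qed

definition supp :: "('i \<Rightarrow> complex) \<Rightarrow> 'i set" where
  "supp f = {i. f i \<noteq> 1}"

text \<open>The homomorphisms from \<open>G\<close> into the direct sum of copies of the group of roots of
  unity, indexed by \<open>'i\<close>.\<close>

definition char_family :: "('a, 'm) monoid_scheme \<Rightarrow> ('a \<Rightarrow> 'i \<Rightarrow> complex) \<Rightarrow> bool" where
  "char_family G \<chi> \<longleftrightarrow>
     (\<forall>a\<in>carrier G. \<forall>b\<in>carrier G. \<forall>i. \<chi> (a \<otimes>\<^bsub>G\<^esub> b) i = \<chi> a i * \<chi> b i) \<and>
     (\<forall>a\<in>carrier G. finite (supp (\<chi> a)) \<and> (\<forall>i. \<chi> a i \<in> unity_roots))"

context
  fixes G :: "('a, 'm) monoid_scheme" and \<chi> :: "'a \<Rightarrow> 'i \<Rightarrow> complex"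
  assumes grp: "group G" and chi: "char_family G \<chi>"
begin

interpretation group G by (rule grp)

lemma chi_mult: "a \<in> carrier G \<Longrightarrow> b \<in> carrier G \<Longrightarrow> \<chi> (a \<otimes>\<^bsub>G\<^esub> b) i = \<chi> a i * \<chi> b i"
  using chi unfolding char_family_def by blast

lemma chi_root: "a \<in> carrier G \<Longrightarrow> \<chi> a i \<in> unity_roots"
  using chi unfolding char_family_def by blast

lemma finite_supp_chi: "a \<in> carrier G \<Longrightarrow> finite (supp (\<chi> a))"
  using chi unfolding char_family_def by blast

lemma chi_inv:
  assumes "a \<in> carrier G"
  shows "\<chi> (inv\<^bsub>G\<^esub> a) i = inverse (\<chi> a i)"
proof -
  have "\<chi> \<one>\<^bsub>G\<^esub> i = 1"
    using chi_mult[of "\<one>\<^bsub>G\<^esub>" "\<one>\<^bsub>G\<^esub>" i] unity_root_neq_0[OF chi_root[of "\<one>\<^bsub>G\<^esub>" i]] by simp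
  then have "\<chi> a i * \<chi> (inv\<^bsub>G\<^esub> a) i = 1" using assms chi_mult[of a "inv\<^bsub>G\<^esub> a" i] by simp
  then show ?thesis by (simp add: inverse_unique)
qed

lemma supp_mult_subset:
  assumes "a \<in> carrier G" "b \<in> carrier G"
  shows "supp (\<chi> (a \<otimes>\<^bsub>G\<^esub> b)) \<subseteq> supp (\<chi> a) \<union> supp (\<chi> b)"
  using assms by (auto simp: supp_def chi_mult)

lemma supp_inv: "a \<in> carrier G \<Longrightarrow> supp (\<chi> (inv\<^bsub>G\<^esub> a)) = supp (\<chi> a)"
  by (auto simp: supp_def chi_inv)

text \<open>Otherwise \<open>\<chi> a\<close> is determined by its restriction to \<open>Y\<close>: if \<open>a\<close> and \<open>b\<close> have
  the same restriction, the support of \<open>\<chi> (a b\<^sup>-\<^sup>1)\<close> misses \<open>Y\<close> and so is empty. A restriction is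
  coded by a finite set of pairs of a coordinate and a number, so there are fewer than
  \<open>|carrier G|\<close> restrictions, hence fewer than \<open>|carrier G|\<close> supports. These are finite and
  cannot exhaust the coordinates that occur.\<close>

lemma ex_supp_disjoint:
  fixes Y :: "'i set"
  assumes unc: "uncountable (carrier G)"
    and many: "|carrier G| \<le>o |\<Union>a\<in>carrier G. supp (\<chi> a)|"
    and Y: "|Y| <o |carrier G|"
  shows "\<exists>g\<in>carrier G. supp (\<chi> g) \<noteq> {} \<and> supp (\<chi> g) \<inter> Y = {}"
proof (rule ccontr)
  assume "\<not> ?thesis"
  then have triv: "supp (\<chi> g) = {}" if "g \<in> carrier G" "supp (\<chi> g) \<inter> Y = {}" for g
    using that by blast
  \<comment> \<open>The summand \<open>nat\<close> makes \<open>Z\<close> infinite and provides codes for the roots of unity.\<close>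
  define Z where "Z = Y <+> (UNIV :: nat set)"
  define r where "r a = (\<lambda>y. (Inl y :: 'i + nat, Inr (to_nat_on unity_roots (\<chi> a y)) :: 'i + nat))
      ` (supp (\<chi> a) \<inter> Y)" for a
  have infG: "infinite (carrier G)" using unc countable_finite by blast
  have infZ: "infinite Z" unfolding Z_def by simp
  have ltN: "|UNIV::nat set| <o |carrier G|"
    by (rule uncountable_nat_ordLess[OF unc])
  have Zlt: "|Z| <o |carrier G|"
    unfolding Z_def by (rule card_of_Plus_ordLess_infinite[OF infG Y ltN])
  have eq: "supp (\<chi> a) = supp (\<chi> b)" if a: "a \<in> carrier G" and b: "b \<in> carrier G" and r: "r a = r b" for a b
  proof -
    have mem: "(Inl y, Inr n) \<in> r c \<longleftrightarrow> y \<in> supp (\<chi> c) \<inter> Y \<and> n = to_nat_on unity_roots (\<chi> c y)" for y n c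
      unfolding r_def by auto
    have "\<chi> a y = \<chi> b y" if "y \<in> Y" for y
    proof (cases "y \<in> supp (\<chi> a)")
      case True
      then have "(Inl y, Inr (to_nat_on unity_roots (\<chi> a y))) \<in> r b" using that mem r by blast
      then have "to_nat_on unity_roots (\<chi> a y) = to_nat_on unity_roots (\<chi> b y)" using mem by blast
      then show ?thesis using chi_root a b countable_unity_roots by (metis to_nat_on_inj)
    next
      case False
      then have "y \<notin> supp (\<chi> b)" using mem[of y _ b] mem[of y _ a] r that by blast
      then show ?thesis using False by (simp add: supp_def)
    qed
    then have "supp (\<chi> (a \<otimes>\<^bsub>G\<^esub> inv\<^bsub>G\<^esub> b)) \<inter> Y = {}"
      using a b unity_root_neq_0[OF chi_root[OF b]] by (auto simp: supp_def chi_mult chi_inv)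
    then have "supp (\<chi> (a \<otimes>\<^bsub>G\<^esub> inv\<^bsub>G\<^esub> b)) = {}" using triv a b by simp
    then have "\<chi> a i = \<chi> b i" for i
      using a b unity_root_neq_0[OF chi_root[OF b]] by (auto simp: supp_def chi_mult chi_inv field_simps)
    then show ?thesis by (simp add: supp_def)
  qed
  have "r ` carrier G \<subseteq> Fpow (Z \<times> Z)"
    using finite_supp_chi unfolding r_def Fpow_def Z_def by auto
  then have "|r ` carrier G| \<le>o |Fpow (Z \<times> Z)|" by (rule card_of_mono1)
  also have "|Fpow (Z \<times> Z)| =o |Z \<times> Z|"
    using infZ by (intro card_of_Fpow_infinite) (auto simp: finite_cartesian_product_iff)
  also have "|Z \<times> Z| =o |Z|" by (rule card_of_Times_same_infinite[OF infZ])
  finally have rZ: "|r ` carrier G| \<le>o |Z|" .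
  define s where "s P = supp (\<chi> (SOME a. a \<in> carrier G \<and> r a = P))" for P
  have s: "s (r a) = supp (\<chi> a)" if "a \<in> carrier G" for a
    unfolding s_def using that eq by (metis (mono_tags, lifting) someI_ex)
  have "|\<Union>P\<in>r ` carrier G. s P| \<le>o |Z|"
  proof (rule card_of_UNION_ordLeq_infinite[OF infZ rZ], intro ballI)
    fix P assume "P \<in> r ` carrier G"
    then have "finite (s P)" using s finite_supp_chi by force
    then show "|s P| \<le>o |Z|" using infZ by (simp add: ordLess_imp_ordLeq)
  qed
  then have "|\<Union>a\<in>carrier G. supp (\<chi> a)| \<le>o |Z|" using s by simp
  then have "|carrier G| \<le>o |Z|" using many ordLeq_transitive by blast
  then show False using Zlt not_ordLess_ordLeq by blast
qed

text \<open>Elements with pairwise disjoint supports are multiplied; each new support is chosen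
  disjoint from \<open>Y\<close> and from the previous ones, so that nothing cancels.\<close>

lemma ex_large_supp_disjoint:
  fixes Y :: "'i set"
  assumes unc: "uncountable (carrier G)"
    and many: "|carrier G| \<le>o |\<Union>a\<in>carrier G. supp (\<chi> a)|"
    and Y: "|Y| <o |carrier G|"
  shows "\<exists>g\<in>carrier G. card (supp (\<chi> g)) \<ge> n \<and> supp (\<chi> g) \<inter> Y = {}"
proof (induction n)
  case 0
  then show ?case using ex_supp_disjoint[OF assms] by auto
next
  case (Suc n)
  then obtain g where g: "g \<in> carrier G" "card (supp (\<chi> g)) \<ge> n" "supp (\<chi> g) \<inter> Y = {}"
    by blast
  have infG: "infinite (carrier G)" using unc countable_finite by blast
  have "|Y \<union> supp (\<chi> g)| <o |carrier G|"
    using infG Y g(1) finite_supp_chi by (intro card_of_Un_ordLess_infinite) auto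
  from ex_supp_disjoint[OF unc many this]
  obtain h where h: "h \<in> carrier G" "supp (\<chi> h) \<noteq> {}" "supp (\<chi> h) \<inter> (Y \<union> supp (\<chi> g)) = {}"
    by blast
  have "supp (\<chi> (g \<otimes>\<^bsub>G\<^esub> h)) = supp (\<chi> g) \<union> supp (\<chi> h)"
  proof
    show "supp (\<chi> g) \<union> supp (\<chi> h) \<subseteq> supp (\<chi> (g \<otimes>\<^bsub>G\<^esub> h))"
    proof
      fix i assume "i \<in> supp (\<chi> g) \<union> supp (\<chi> h)"
      then have "\<chi> g i \<noteq> 1 \<and> \<chi> h i = 1 \<or> \<chi> g i = 1 \<and> \<chi> h i \<noteq> 1"
        using h(3) by (auto simp: supp_def)
      then show "i \<in> supp (\<chi> (g \<otimes>\<^bsub>G\<^esub> h))"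
        using g(1) h(1) by (auto simp: supp_def chi_mult)
    qed
  qed (use g h supp_mult_subset in blast)
  moreover have "card (supp (\<chi> g) \<union> supp (\<chi> h)) = card (supp (\<chi> g)) + card (supp (\<chi> h))"
    using g h finite_supp_chi by (intro card_Un_disjoint) auto
  moreover have "card (supp (\<chi> h)) > 0" using h finite_supp_chi by (simp add: card_gt_0_iff)
  ultimately show ?case using g h by (intro bexI[of _ "g \<otimes>\<^bsub>G\<^esub> h"]) auto
qed

lemma cover_of_bounded_supp:
  assumes unc: "uncountable (carrier G)"
    and many: "|carrier G| \<le>o |\<Union>a\<in>carrier G. supp (\<chi> a)|"
    and B: "B \<subseteq> carrier G" "\<And>b. b \<in> B \<Longrightarrow> card (supp (\<chi> b)) \<le> n"
    and X: "covers G B X"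
  shows "|carrier G| \<le>o |X|"
proof (rule ccontr)
  assume "\<not> ?thesis"
  then have X1: "|X| <o |carrier G|" by (simp add: not_ordLeq_iff_ordLess)
  have XG: "X \<subseteq> carrier G" and cov: "carrier G = X <#>\<^bsub>G\<^esub> B" using X by (auto simp: covers_def)
  \<comment> \<open>An infinite bound for \<open>|X|\<close>, so that unions of finite sets over \<open>X\<close> stay below it.\<close>
  define Z where "Z = X <+> (UNIV :: nat set)"
  have infG: "infinite (carrier G)" using unc countable_finite by blast
  have infZ: "infinite Z" unfolding Z_def by simp
  have ltN: "|UNIV::nat set| <o |carrier G|"
    by (rule uncountable_nat_ordLess[OF unc])
  have Zlt: "|Z| <o |carrier G|"
    unfolding Z_def by (rule card_of_Plus_ordLess_infinite[OF infG X1 ltN])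
  have "|\<Union>x\<in>X. supp (\<chi> x)| \<le>o |Z|"
  proof (rule card_of_UNION_ordLeq_infinite[OF infZ], goal_cases)
    case 1 show ?case unfolding Z_def by (rule card_of_Plus1)
  next
    case 2 show ?case using XG infZ finite_supp_chi by (auto intro!: ordLess_imp_ordLeq)
  qed
  then have "|\<Union>x\<in>X. supp (\<chi> x)| <o |carrier G|" using Zlt ordLeq_ordLess_trans by blast
  from ex_large_supp_disjoint[OF unc many this, of "Suc n"]
  obtain g where g: "g \<in> carrier G" "card (supp (\<chi> g)) > n"
     "supp (\<chi> g) \<inter> (\<Union>x\<in>X. supp (\<chi> x)) = {}" by auto
  obtain x b where xb: "x \<in> X" "b \<in> B" "g = x \<otimes>\<^bsub>G\<^esub> b"
    using g(1) cov unfolding set_mult_def by auto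
  have xbG: "x \<in> carrier G" "b \<in> carrier G" using xb XG B by auto
  have "supp (\<chi> g) \<subseteq> supp (\<chi> b)"
  proof
    fix i assume i: "i \<in> supp (\<chi> g)"
    then have "\<chi> x i = 1" using g(3) xb(1) by (auto simp: supp_def)
    then show "i \<in> supp (\<chi> b)" using i xbG by (simp add: supp_def chi_mult xb(3))
  qed
  then have "card (supp (\<chi> g)) \<le> card (supp (\<chi> b))"
    using finite_supp_chi xbG by (intro card_mono) auto
  then show False using B(2)[OF xb(2)] g(2) by simp
qed

text \<open>Not every natural number need be the size of a support, and cells must be nonempty: the
  level sets are therefore indexed by enumerating the sizes that occur.\<close>

lemma partition_of_char_family:
  assumes unc: "uncountable (carrier G)"
    and many: "|carrier G| \<le>o |\<Union>a\<in>carrier G. supp (\<chi> a)|"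
  shows "\<exists>A :: nat \<Rightarrow> 'a set.
           (\<forall>n. A n \<noteq> {}) \<and> disjoint_family A \<and> (\<Union>n. A n) = carrier G \<and>
           (\<forall>n. cov G (A n <#>\<^bsub>G\<^esub> set_inv\<^bsub>G\<^esub> (A n)) =o |carrier G| )"
proof -
  define l where "l g = card (supp (\<chi> g))" for g
  define L where "L = l ` carrier G"
  have infG: "infinite (carrier G)" using unc countable_finite by blast
  have "\<exists>m\<ge>n. m \<in> L" for n
  proof -
    have "|{}::'i set| <o |carrier G|" using infG by (intro finite_ordLess_infinite2) auto
    from ex_large_supp_disjoint[OF unc many this, of n] show ?thesis unfolding L_def l_def by auto
  qed
  then have infL: "infinite L" by (simp add: infinite_nat_iff_unbounded_le)
  define A where "A n = {g \<in> carrier G. l g = Infinite_Set.enumerate L n}" for n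
  have ne: "A n \<noteq> {}" for n
    using enumerate_in_set[OF infL, of n] unfolding A_def L_def by auto
  have "disjoint_family A"
    unfolding disjoint_family_on_def
  proof (intro ballI impI)
    fix m n :: nat assume "m \<noteq> n"
    then have "Infinite_Set.enumerate L m \<noteq> Infinite_Set.enumerate L n"
      using inj_enumerate[OF infL] by (simp add: inj_eq)
    then show "A m \<inter> A n = {}" unfolding A_def by auto
  qed
  moreover have "(\<Union>n. A n) = carrier G"
  proof -
    have "g \<in> (\<Union>n. A n)" if "g \<in> carrier G" for g
      using range_enumerate[OF infL] that unfolding A_def L_def by blast
    then show ?thesis unfolding A_def by auto
  qed
  moreover have "cov G (A n <#>\<^bsub>G\<^esub> set_inv\<^bsub>G\<^esub> (A n)) =o |carrier G|" for n
  proof -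
    define B where "B = A n <#>\<^bsub>G\<^esub> set_inv\<^bsub>G\<^esub> (A n)"
    have AG: "A n \<subseteq> carrier G" unfolding A_def by auto
    have BG: "B \<subseteq> carrier G" using AG unfolding B_def set_mult_def SET_INV_def by auto
    have Bne: "B \<noteq> {}" using ne[of n] unfolding B_def set_mult_def SET_INV_def by auto
    have bound: "card (supp (\<chi> b)) \<le> 2 * Infinite_Set.enumerate L n" if "b \<in> B" for b
    proof -
      obtain c d where cd: "c \<in> A n" "d \<in> A n" "b = c \<otimes>\<^bsub>G\<^esub> inv\<^bsub>G\<^esub> d"
        using \<open>b \<in> B\<close> unfolding B_def set_mult_def SET_INV_def by auto
      have G: "c \<in> carrier G" "d \<in> carrier G" using cd AG by auto
      have "supp (\<chi> b) \<subseteq> supp (\<chi> c) \<union> supp (\<chi> d)"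
        using supp_mult_subset[of c "inv\<^bsub>G\<^esub> d"] supp_inv[of d] G cd(3) by simp
      then have "card (supp (\<chi> b)) \<le> card (supp (\<chi> c) \<union> supp (\<chi> d))"
        using G finite_supp_chi by (intro card_mono) auto
      also have "\<dots> \<le> card (supp (\<chi> c)) + card (supp (\<chi> d))" by (rule card_Un_le)
      finally show ?thesis using cd unfolding A_def l_def by simp
    qed
    obtain X where X: "covers G B X" "cov G B = |X|" using cov_attained[OF grp BG Bne] by blast
    have "|carrier G| \<le>o cov G B"
      using cover_of_bounded_supp[OF unc many BG bound X(1)] X(2) by simp
    moreover have "cov G B \<le>o |carrier G|" by (rule cov_le[OF covers_carrier[OF grp BG Bne]])
    ultimately show ?thesis unfolding B_def ordIso_iff_ordLeq by blast
  qed
  ultimately show ?thesis using ne by blast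
qed

end

lemma countable_group_partition:
  fixes G :: "('a, 'm) monoid_scheme"
  assumes grp: "group G" and inf: "infinite (carrier G)" and cnt: "countable (carrier G)"
  shows "\<exists>A :: nat \<Rightarrow> 'a set.
           (\<forall>n. A n \<noteq> {}) \<and> disjoint_family A \<and> (\<Union>n. A n) = carrier G \<and>
           (\<forall>n. cov G (A n <#>\<^bsub>G\<^esub> set_inv\<^bsub>G\<^esub> (A n)) =o |carrier G| )"
proof -
  interpret group G by (rule grp)
  define e where "e = from_nat_into (carrier G)"
  have e: "bij_betw e UNIV (carrier G)"
    unfolding e_def using cnt inf by (rule bij_betw_from_nat_into)
  have one: "{e n} <#>\<^bsub>G\<^esub> set_inv\<^bsub>G\<^esub> {e n} = {\<one>\<^bsub>G\<^esub>}" for n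
    using bij_betwE[OF e] by (auto simp: set_mult_def SET_INV_def)
  have "cov G {\<one>\<^bsub>G\<^esub>} =o |carrier G|"
  proof -
    obtain X where X: "covers G {\<one>\<^bsub>G\<^esub>} X" "cov G {\<one>\<^bsub>G\<^esub>} = |X|"
      using cov_attained[OF grp, of "{\<one>\<^bsub>G\<^esub>}"] by auto
    then have XG: "X \<subseteq> carrier G" "carrier G = X <#>\<^bsub>G\<^esub> {\<one>\<^bsub>G\<^esub>}" by (auto simp: covers_def)
    have "X <#>\<^bsub>G\<^esub> {\<one>\<^bsub>G\<^esub>} = X" using XG(1) by (force simp: set_mult_def)
    then show ?thesis using X(2) XG(2) by simp
  qed
  moreover have "disjoint_family (\<lambda>n. {e n})"
    using bij_betw_imp_inj_on[OF e] by (simp add: disjoint_family_on_def inj_eq)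
  moreover have "(\<Union>n. {e n}) = carrier G"
    using bij_betw_imp_surj_on[OF e] by (simp add: UNION_singleton_eq_range)
  ultimately show ?thesis
    using one by (intro exI[of _ "\<lambda>n. {e n}"]) simp
qed

section \<open>Words\<close>

lemma word_value_closed:
  assumes "group G" "fst ` set w \<subseteq> carrier G"
  shows "word_value G w \<in> carrier G"
proof -
  interpret group G by fact
  show ?thesis using assms(2) by (induction w) auto
qed

lemma word_value_append:
  assumes "group G" "fst ` set v \<subseteq> carrier G" "fst ` set w \<subseteq> carrier G"
  shows "word_value G (v @ w) = word_value G v \<otimes>\<^bsub>G\<^esub> word_value G w"
proof -
  interpret group G by fact
  note closed = word_value_closed[OF assms(1)]
  show ?thesis using assms(2) by (induction v) (auto simp: m_assoc closed assms(3))
qed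

text \<open>Every element of the group is the value of a word over \<open>M\<close>, and an infinite \<open>M\<close> has
  only \<open>|M|\<close> words.\<close>

lemma card_generate_le:
  fixes G :: "('a, 'm) monoid_scheme"
  assumes grp: "group G" and MG: "M \<subseteq> carrier G"
    and gen: "carrier G \<subseteq> generate G M" and unc: "uncountable (carrier G)"
  shows "|carrier G| \<le>o |M|"
proof -
  interpret group G by (rule grp)
  let ?W = "lists (M \<times> (UNIV :: bool set))"
  have "g \<in> word_value G ` ?W" if "g \<in> generate G M" for g
    using that
  proof (induction rule: generate.induct)
    case one
    show ?case by (intro image_eqI[of _ _ "[]"]) auto
  next
    case (incl h)
    then show ?case using MG by (intro image_eqI[of _ _ "[(h, True)]"]) auto
  next
    case (inv h)
    then show ?case using MG by (intro image_eqI[of _ _ "[(h, False)]"]) auto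
  next
    case (eng g h)
    then obtain v w where "v \<in> ?W" "w \<in> ?W" "g = word_value G v" "h = word_value G w" by blast
    moreover from this have "fst ` set v \<subseteq> carrier G" "fst ` set w \<subseteq> carrier G" using MG by auto
    ultimately show ?case using word_value_append[OF grp] by (intro image_eqI[of _ _ "v @ w"]) auto
  qed
  then have sub: "carrier G \<subseteq> word_value G ` ?W" using gen by blast
  have infM: "infinite M"
  proof
    assume "finite M"
    then have "countable ?W" by (intro countable_lists countable_finite) simp
    then have "countable (word_value G ` ?W)" by (rule countable_image)
    then show False using countable_subset[OF sub] unc by simp
  qed
  have "|carrier G| \<le>o |?W|" by (rule surj_imp_ordLeq[OF sub])
  also have "|?W| =o |M \<times> (UNIV::bool set)|"
    using infM by (intro card_of_lists_infinite) (auto simp: finite_cartesian_product_iff)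
  also have "|M \<times> (UNIV::bool set)| =o |M|"
    using card_of_Times_infinite[of M "UNIV::bool set"] infM by (simp add: ordLess_imp_ordLeq)
  finally show ?thesis .
qed

section \<open>Extending characters in Abelian groups\<close>

text \<open>A partial homomorphism is given by its graph \<open>F\<close>, so that unions of chains are again such
  graphs. The coordinates are labelled by group elements. Labels in use lie in the domain, so every
  element outside the domain is a fresh label; and the labels in use generate the domain, so
  there are many of them once the domain is all of \<open>G\<close>.\<close>

definition partial_char_graph :: "('a, 'm) monoid_scheme \<Rightarrow> ('a \<times> ('a \<Rightarrow> complex)) set \<Rightarrow> bool" where
  "partial_char_graph G F \<longleftrightarrow>
     (\<forall>(a, f)\<in>F. a \<in> carrier G \<and> finite (supp f) \<and> (\<forall>x. f x \<in> unity_roots)) \<and>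
     (\<one>\<^bsub>G\<^esub>, \<lambda>_. 1) \<in> F \<and>
     (\<forall>(a, f)\<in>F. \<forall>(b, g)\<in>F. (a \<otimes>\<^bsub>G\<^esub> inv\<^bsub>G\<^esub> b, \<lambda>x. f x / g x) \<in> F) \<and>
     (\<forall>f. (\<one>\<^bsub>G\<^esub>, f) \<in> F \<longrightarrow> f = (\<lambda>_. 1)) \<and>
     (\<forall>(a, f)\<in>F. supp f \<subseteq> fst ` F) \<and>
     fst ` F \<subseteq> generate G (\<Union>(a, f)\<in>F. supp f)"

context
  fixes G :: "('a, 'm) monoid_scheme" and F :: "('a \<times> ('a \<Rightarrow> complex)) set"
  assumes grp: "comm_group G" and F: "partial_char_graph G F"
begin

interpretation comm_group G by (rule grp)

lemma graph_carrier: "(a, f) \<in> F \<Longrightarrow> a \<in> carrier G"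
  and graph_finite: "(a, f) \<in> F \<Longrightarrow> finite (supp f)"
  and graph_root: "(a, f) \<in> F \<Longrightarrow> f x \<in> unity_roots"
  and graph_one: "(\<one>\<^bsub>G\<^esub>, \<lambda>_. 1) \<in> F"
  and graph_quot: "(a, f) \<in> F \<Longrightarrow> (b, g) \<in> F \<Longrightarrow> (a \<otimes>\<^bsub>G\<^esub> inv\<^bsub>G\<^esub> b, \<lambda>x. f x / g x) \<in> F"
  and graph_functional: "(\<one>\<^bsub>G\<^esub>, f) \<in> F \<Longrightarrow> f = (\<lambda>_. 1)"
  and graph_labels: "(a, f) \<in> F \<Longrightarrow> supp f \<subseteq> fst ` F"
  and graph_generate: "fst ` F \<subseteq> generate G (\<Union>(a, f)\<in>F. supp f)"
  using F unfolding partial_char_graph_def by fast+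

lemma graph_mult:
  assumes "(a, f) \<in> F" "(b, g) \<in> F"
  shows "(a \<otimes>\<^bsub>G\<^esub> b, \<lambda>x. f x * g x) \<in> F"
proof -
  have "(\<one>\<^bsub>G\<^esub> \<otimes>\<^bsub>G\<^esub> inv\<^bsub>G\<^esub> b, \<lambda>x. 1 / g x) \<in> F" by (rule graph_quot[OF graph_one assms(2)])
  from graph_quot[OF assms(1) this] show ?thesis
    using graph_carrier[OF assms(2)] by simp
qed

lemma graph_unique:
  assumes "(a, f) \<in> F" "(a, g) \<in> F"
  shows "f = g"
proof
  fix x
  have "(\<lambda>x. f x / g x) = (\<lambda>_. 1)"
    using graph_quot[OF assms] graph_carrier[OF assms(1)] by (intro graph_functional) simp
  then have "f x / g x = 1" by meson
  then show "f x = g x" by simp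
qed

lemma graph_pow:
  assumes "(a, f) \<in> F"
  shows "(a [^]\<^bsub>G\<^esub> (k::int), \<lambda>x. f x powi k) \<in> F"
proof -
  have a: "a \<in> carrier G" by (rule graph_carrier[OF assms])
  have nat: "(a [^]\<^bsub>G\<^esub> n, \<lambda>x. f x ^ n) \<in> F" for n :: nat
  proof (induction n)
    case 0
    show ?case using graph_one by simp
  next
    case (Suc n)
    from graph_mult[OF this assms] show ?case by (simp add: mult.commute)
  qed
  show ?thesis
  proof (cases k rule: int_cases2)
    case (nonneg n)
    show ?thesis using nat[of n] by (simp only: nonneg int_pow_int power_int_of_nat)
  next
    case (nonpos n)
    have "inv\<^bsub>G\<^esub> (a [^]\<^bsub>G\<^esub> n) = \<one>\<^bsub>G\<^esub> \<otimes>\<^bsub>G\<^esub> inv\<^bsub>G\<^esub> (a [^]\<^bsub>G\<^esub> n)" using a by simp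
    then show ?thesis using graph_quot[OF graph_one nat[of n]]
      by (simp only: nonpos int_pow_neg_int[OF a] power_int_minus power_int_of_nat inverse_eq_divide)
  qed
qed

lemma graph_domain_subgroup: "subgroup (fst ` F) G"
proof (rule subgroupI)
  show "fst ` F \<subseteq> carrier G" using graph_carrier by auto
  show "fst ` F \<noteq> {}" using graph_one by auto
next
  fix a assume "a \<in> fst ` F"
  then obtain f where f: "(a, f) \<in> F" by auto
  show "inv\<^bsub>G\<^esub> a \<in> fst ` F"
    using graph_pow[OF f, of "-1"] graph_carrier[OF f] by (force simp: int_pow_neg)
next
  fix a b assume "a \<in> fst ` F" "b \<in> fst ` F"
  then show "a \<otimes>\<^bsub>G\<^esub> b \<in> fst ` F" using graph_mult by force
qed

text \<open>The order of \<open>g\<close> modulo the domain, with \<open>n = 0\<close> for infinite order.\<close>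

lemma ex_order_mod_domain:
  assumes g: "g \<in> carrier G"
  shows "\<exists>n::nat. \<forall>k::int. g [^]\<^bsub>G\<^esub> k \<in> fst ` F \<longleftrightarrow> int n dvd k"
proof -
  interpret K: subgroup "fst ` F" G by (rule graph_domain_subgroup)
  define S where "S = {k::int. g [^]\<^bsub>G\<^esub> k \<in> fst ` F}"
  have S0: "0 \<in> S" unfolding S_def by simp
  have Sdiff: "k - l \<in> S" if "k \<in> S" "l \<in> S" for k l
    using that g K.m_closed K.m_inv_closed unfolding S_def by (simp add: int_pow_diff)
  have Sminus: "- k \<in> S" if "k \<in> S" for k using Sdiff[OF S0 that] by simp
  have Smult: "k * j \<in> S" if "k \<in> S" for k j
    using that subgroup_int_pow_closed[OF graph_domain_subgroup, of "g [^]\<^bsub>G\<^esub> k" j] g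
    unfolding S_def by (simp add: int_pow_pow)
  have "\<exists>n. S = {k. int n dvd k}"
  proof (cases "\<exists>n>0. int n \<in> S")
    case False
    have "k = 0" if "k \<in> S" for k
    proof (rule ccontr)
      assume "k \<noteq> 0"
      moreover have "\<bar>k\<bar> \<in> S" using that Sminus by (simp add: abs_if)
      ultimately show False using False by (metis nat_int zero_less_abs_iff zero_less_nat_eq int_nat_eq abs_ge_zero)
    qed
    then show ?thesis using S0 by (intro exI[of _ 0]) auto
  next
    case True
    define n where "n = (LEAST n. n > 0 \<and> int n \<in> S)"
    have n: "n > 0" "int n \<in> S" using LeastI_ex[OF True] unfolding n_def by auto
    have "int n dvd k" if "k \<in> S" for k
    proof -
      have "k mod int n \<in> S"
        using Sdiff[OF that Smult[OF n(2), of "k div int n"]] by (simp add: minus_mult_div_eq_mod)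
      moreover have "nat (k mod int n) < n" using n(1) by (simp add: nat_less_iff)
      ultimately have "\<not> nat (k mod int n) > 0"
        using not_less_Least[of "nat (k mod int n)" "\<lambda>n. n > 0 \<and> int n \<in> S"] n(1)
        unfolding n_def[symmetric] by auto
      then have "k mod int n = 0" using n(1) pos_mod_sign[of "int n" k] by linarith
      then show ?thesis by auto
    qed
    moreover have "k \<in> S" if "int n dvd k" for k using that Smult[OF n(2)] by (auto elim: dvdE)
    ultimately show ?thesis by (intro exI[of _ n]) auto
  qed
  then show ?thesis unfolding S_def by blast
qed

text \<open>With \<open>n\<close> the order of \<open>g\<close> modulo the domain and \<open>f0\<close> the value at \<open>g\<^sup>n\<close>, any
  \<open>h\<close> with \<open>h\<^sup>n = f0\<close> may be prescribed as the value at \<open>g\<close>. The coordinate labelled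
  \<open>g\<close> is trivial on the domain, so there \<open>h\<close> may be a nontrivial \<open>n\<close>-th root of unity,
  which exists because \<open>n \<noteq> 1\<close>; this puts the label \<open>g\<close> into use.\<close>

lemma ex_proper_extension:
  assumes g: "g \<in> carrier G" and new: "g \<notin> fst ` F"
  shows "\<exists>F'. partial_char_graph G F' \<and> F \<subset> F'"
proof -
  interpret K: subgroup "fst ` F" G by (rule graph_domain_subgroup)
  obtain n :: nat where n: "\<And>k::int. g [^]\<^bsub>G\<^esub> k \<in> fst ` F \<longleftrightarrow> int n dvd k"
    using ex_order_mod_domain[OF g] by blast
  have n1: "n \<noteq> 1" using n[of 1] new g by auto
  obtain f0 where f0: "(g [^]\<^bsub>G\<^esub> int n, f0) \<in> F" using n[of "int n"] by auto
  have f0': "f0 = (\<lambda>_. 1)" if "n = 0" using f0 that graph_functional by simp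
  obtain u where u: "u \<in> unity_roots" "u \<noteq> 1" "u ^ n = 1" using nontrivial_unity_root[OF n1] by blast
  \<comment> \<open>Taking the root \<open>1\<close> wherever \<open>f0\<close> is \<open>1\<close> keeps the support finite.\<close>
  have "\<exists>y\<in>unity_roots. y ^ n = f0 x \<and> (f0 x = 1 \<longrightarrow> y = 1)" for x
  proof (cases "f0 x = 1")
    case False
    then have "n > 0" using f0' by auto
    then show ?thesis using unity_root_divisible graph_root[OF f0] False by blast
  qed (auto intro!: bexI[of _ 1])
  then obtain r where r: "\<And>x. r x \<in> unity_roots" "\<And>x. r x ^ n = f0 x" "\<And>x. f0 x = 1 \<Longrightarrow> r x = 1"
    by metis
  define h where "h = r(g := u)"
  have f0g: "f0 g = 1" using graph_labels[OF f0] new unfolding supp_def by blast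
  have h_root: "h x \<in> unity_roots" for x using r u unfolding h_def by simp
  have h0: "h x \<noteq> 0" for x by (rule unity_root_neq_0[OF h_root])
  have h_pow: "h x ^ n = f0 x" for x using r u f0g unfolding h_def by simp
  have supp_h: "supp h \<subseteq> insert g (supp f0)" using r(3) unfolding h_def supp_def by auto
  have gh: "g \<in> supp h" using u unfolding h_def supp_def by simp
  define E where "E a f k = (a \<otimes>\<^bsub>G\<^esub> g [^]\<^bsub>G\<^esub> (k::int), \<lambda>x. f x * h x powi k)" for a f k
  define F' where "F' = {E a f k | a f k. (a, f) \<in> F}"
  have sub: "F \<subseteq> F'"
  proof (rule subrelI)
    fix a f assume "(a, f) \<in> F"
    moreover from this have "(a, f) = E a f 0" using graph_carrier unfolding E_def by simp
    ultimately show "(a, f) \<in> F'" unfolding F'_def by blast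
  qed
  have "(g, h) = E \<one>\<^bsub>G\<^esub> (\<lambda>_. 1) 1" using g unfolding E_def by simp
  then have ghF': "(g, h) \<in> F'" using graph_one unfolding F'_def by blast
  have supp_E: "supp (\<lambda>x. f x * h x powi k) \<subseteq> supp f \<union> insert g (supp f0)" for f k
  proof
    fix x assume "x \<in> supp (\<lambda>x. f x * h x powi k)"
    then have "f x \<noteq> 1 \<or> h x \<noteq> 1" by (auto simp: supp_def)
    then show "x \<in> supp f \<union> insert g (supp f0)" using supp_h unfolding supp_def by blast
  qed
  define L where "L = (\<Union>(a, f)\<in>F. supp f)"
  define L' where "L' = (\<Union>(a, f)\<in>F'. supp f)"
  have LL': "insert g L \<subseteq> L'" 
  proof -
    have "L \<subseteq> L'" unfolding L_def L'_def using sub by (rule UN_mono) simp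
    moreover have "g \<in> L'" unfolding L'_def by (rule UN_I[OF ghF']) (simp add: gh)
    ultimately show ?thesis by simp
  qed
  have F'E: "\<exists>a f k. (a, f) \<in> F \<and> p = E a f k" if "p \<in> F'" for p
    using that unfolding F'_def by blast
  have L'G: "L' \<subseteq> carrier G"
  proof -
    have FG: "supp f \<subseteq> carrier G" if "(a, f) \<in> F" for a f
      using graph_labels[OF that] K.subset by blast
    have "supp f \<subseteq> carrier G" if "(a, f) \<in> F'" for a f
    proof -
      obtain b f' k where b: "(b, f') \<in> F" "(a, f) = E b f' k" using F'E[OF \<open>(a, f) \<in> F'\<close>] by blast
      then have "supp f \<subseteq> supp f' \<union> insert g (supp f0)" using supp_E unfolding E_def by simp
      then show ?thesis using FG[OF b(1)] FG[OF f0] g by blast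
    qed
    then show ?thesis unfolding L'_def by auto
  qed
  have "partial_char_graph G F'"
    unfolding partial_char_graph_def
  proof (intro conjI allI impI)
    show "\<forall>(a, f)\<in>F'. a \<in> carrier G \<and> finite (supp f) \<and> (\<forall>x. f x \<in> unity_roots)"
    proof clarify
      fix a f assume "(a, f) \<in> F'"
      then obtain b f' k where b: "(b, f') \<in> F" "(a, f) = E b f' k" using F'E by blast
      have "a \<in> carrier G" using b graph_carrier[OF b(1)] g unfolding E_def by simp
      moreover have "finite (supp f)"
        using b(2) finite_subset[OF supp_E[of f' k]] graph_finite[OF f0] graph_finite[OF b(1)]
        unfolding E_def by simp
      moreover have "f x \<in> unity_roots" for x
        using b(2) unity_root_mult[OF graph_root[OF b(1)] unity_root_powi[OF h_root]]
        unfolding E_def by simp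
      ultimately show "a \<in> carrier G \<and> finite (supp f) \<and> (\<forall>x. f x \<in> unity_roots)" by blast
    qed
    show "(\<one>\<^bsub>G\<^esub>, \<lambda>_. 1) \<in> F'" using sub graph_one by blast
    show "\<forall>(a, f)\<in>F'. \<forall>(b, g)\<in>F'. (a \<otimes>\<^bsub>G\<^esub> inv\<^bsub>G\<^esub> b, \<lambda>x. f x / g x) \<in> F'"
    proof clarify
      fix a f b f'
      assume "(a, f) \<in> F'" "(b, f') \<in> F'"
      then obtain c p k d q l where cd: "(c, p) \<in> F" "(a, f) = E c p k" "(d, q) \<in> F" "(b, f') = E d q l"
        using F'E by metis
      have cG: "c \<in> carrier G" "d \<in> carrier G" using cd graph_carrier by auto
      have "a \<otimes>\<^bsub>G\<^esub> inv\<^bsub>G\<^esub> b = (c \<otimes>\<^bsub>G\<^esub> inv\<^bsub>G\<^esub> d) \<otimes>\<^bsub>G\<^esub> g [^]\<^bsub>G\<^esub> (k - l)"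
        using cd cG g unfolding E_def by (simp add: int_pow_diff inv_mult m_ac)
      moreover have "f x / f' x = p x / q x * h x powi (k - l)" for x
        using cd h0[of x] unfolding E_def by (simp add: power_int_diff field_simps)
      ultimately have "(a \<otimes>\<^bsub>G\<^esub> inv\<^bsub>G\<^esub> b, \<lambda>x. f x / f' x)
          = E (c \<otimes>\<^bsub>G\<^esub> inv\<^bsub>G\<^esub> d) (\<lambda>x. p x / q x) (k - l)"
        unfolding E_def by simp
      then show "(a \<otimes>\<^bsub>G\<^esub> inv\<^bsub>G\<^esub> b, \<lambda>x. f x / f' x) \<in> F'"
        using graph_quot[OF cd(1,3)] unfolding F'_def by blast
    qed
  next
    fix f assume "(\<one>\<^bsub>G\<^esub>, f) \<in> F'"
    then obtain a f' k where a: "(a, f') \<in> F" "(\<one>\<^bsub>G\<^esub>, f) = E a f' k" using F'E by blast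
    have aG: "a \<in> carrier G" using a graph_carrier by blast
    have one: "a \<otimes>\<^bsub>G\<^esub> g [^]\<^bsub>G\<^esub> k = \<one>\<^bsub>G\<^esub>" using a(2) unfolding E_def by simp
    then have "inv\<^bsub>G\<^esub> a = g [^]\<^bsub>G\<^esub> k" using aG g by (simp add: inv_equality m_comm)
    moreover have "inv\<^bsub>G\<^esub> a \<in> fst ` F" using a(1) by (force intro: K.m_inv_closed)
    ultimately have "int n dvd k" using n by simp
    then obtain j where k: "k = int n * j" by (elim dvdE)
    have "(a \<otimes>\<^bsub>G\<^esub> (g [^]\<^bsub>G\<^esub> int n) [^]\<^bsub>G\<^esub> j, \<lambda>x. f' x * f0 x powi j) \<in> F"
      by (rule graph_mult[OF a(1) graph_pow[OF f0]])
    then have "(\<one>\<^bsub>G\<^esub>, \<lambda>x. f' x * f0 x powi j) \<in> F" using one g unfolding k by (simp add: int_pow_pow)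
    then have "(\<lambda>x. f' x * f0 x powi j) = (\<lambda>_. 1)" by (rule graph_functional)
    moreover have "h x powi k = f0 x powi j" for x unfolding k by (simp add: power_int_mult h_pow)
    ultimately show "f = (\<lambda>_. 1)" using a(2) unfolding E_def by simp
  next
    have dom: "fst ` F \<subseteq> fst ` F'" "g \<in> fst ` F'" using sub ghF' by (auto intro: rev_image_eqI)
    show "\<forall>(a, f)\<in>F'. supp f \<subseteq> fst ` F'"
    proof clarify
      fix a f x assume "(a, f) \<in> F'" and x: "x \<in> supp f"
      then obtain b f' k where b: "(b, f') \<in> F" "(a, f) = E b f' k" using F'E by blast
      then have "x \<in> supp f' \<union> insert g (supp f0)" using supp_E[of f' k] x unfolding E_def by auto
      then show "x \<in> fst ` F'" using graph_labels[OF b(1)] graph_labels[OF f0] dom by blast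
    qed
  next
    show "fst ` F' \<subseteq> generate G (\<Union>(a, f)\<in>F'. supp f)"
      unfolding L'_def[symmetric]
    proof clarify
      fix a f assume "(a, f) \<in> F'"
      then obtain b f' k where b: "(b, f') \<in> F" "(a, f) = E b f' k" using F'E by blast
      interpret L: subgroup "generate G L'" G by (rule generate_is_subgroup[OF L'G])
      have "b \<in> generate G L" using b(1) graph_generate unfolding L_def by force
      then have 1: "b \<in> generate G L'" using mono_generate[of L L'] LL' by blast
      have "g \<in> generate G L'" using LL' by (intro generate.incl) blast
      then have "g [^]\<^bsub>G\<^esub> k \<in> generate G L'" by (rule subgroup_int_pow_closed[OF L.subgroup_axioms])
      then show "fst (a, f) \<in> generate G L'" using 1 b(2) unfolding E_def by (auto intro: L.m_closed)
    qed
  qed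
  moreover have "F \<noteq> F'" using ghF' new by force
  ultimately show ?thesis using sub by blast
qed

end

lemma partial_char_graph_Union:
  fixes G :: "('a, 'm) monoid_scheme"
  assumes grp: "comm_group G" and ne: "\<C> \<noteq> {}"
    and chain: "subset.chain {F. partial_char_graph G F} \<C>"
  shows "partial_char_graph G (\<Union>\<C>)"
proof -
  have mem: "partial_char_graph G F" if "F \<in> \<C>" for F
    using that chain unfolding subset.chain_def by blast
  have two: "\<exists>H\<in>\<C>. p \<in> H \<and> q \<in> H" if "p \<in> \<Union>\<C>" "q \<in> \<Union>\<C>" for p q
    using that chain unfolding subset.chain_def by blast
  show ?thesis
    unfolding partial_char_graph_def
  proof (intro conjI allI impI)
    show "\<forall>(a, f)\<in>\<Union>\<C>. a \<in> carrier G \<and> finite (supp f) \<and> (\<forall>x. f x \<in> unity_roots)"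
      using mem graph_carrier[OF grp] graph_finite[OF grp] graph_root[OF grp] by blast
    show "(\<one>\<^bsub>G\<^esub>, \<lambda>_. 1) \<in> \<Union>\<C>" using ne mem graph_one[OF grp] by blast
    show "\<forall>(a, f)\<in>\<Union>\<C>. \<forall>(b, g)\<in>\<Union>\<C>. (a \<otimes>\<^bsub>G\<^esub> inv\<^bsub>G\<^esub> b, \<lambda>x. f x / g x) \<in> \<Union>\<C>"
    proof clarify
      fix a f b g X Y assume "(a, f) \<in> X" "X \<in> \<C>" "(b, g) \<in> Y" "Y \<in> \<C>"
      then obtain H where "H \<in> \<C>" "(a, f) \<in> H" "(b, g) \<in> H" using two by (meson UnionI)
      then show "(a \<otimes>\<^bsub>G\<^esub> inv\<^bsub>G\<^esub> b, \<lambda>x. f x / g x) \<in> \<Union>\<C>"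
        using graph_quot[OF grp mem] by blast
    qed
    show "f = (\<lambda>_. 1)" if "(\<one>\<^bsub>G\<^esub>, f) \<in> \<Union>\<C>" for f
      using that mem graph_functional[OF grp] by blast
    show "\<forall>(a, f)\<in>\<Union>\<C>. supp f \<subseteq> fst ` \<Union>\<C>"
    proof clarify
      fix a f X x assume "(a, f) \<in> X" "X \<in> \<C>" "x \<in> supp f"
      then have "x \<in> fst ` X" using graph_labels[OF grp mem] by blast
      then show "x \<in> fst ` \<Union>\<C>" using \<open>X \<in> \<C>\<close> by blast
    qed
    show "fst ` \<Union>\<C> \<subseteq> generate G (\<Union>(a, f)\<in>\<Union>\<C>. supp f)"
    proof
      fix x assume "x \<in> fst ` \<Union>\<C>"
      then obtain X where X: "X \<in> \<C>" "x \<in> fst ` X" by blast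
      then have "x \<in> generate G (\<Union>(a, f)\<in>X. supp f)" using graph_generate[OF grp mem] by blast
      moreover have "(\<Union>(a, f)\<in>X. supp f) \<subseteq> (\<Union>(a, f)\<in>\<Union>\<C>. supp f)" using X(1) by blast
      ultimately show "x \<in> generate G (\<Union>(a, f)\<in>\<Union>\<C>. supp f)"
        using group.mono_generate[OF comm_group.axioms(2)[OF grp]] by blast
    qed
  qed
qed

lemma ex_char_family_generate:
  fixes G :: "('a, 'm) monoid_scheme"
  assumes grp: "comm_group G"
  shows "\<exists>\<chi> :: 'a \<Rightarrow> 'a \<Rightarrow> complex. char_family G \<chi> \<and>
           (\<Union>a\<in>carrier G. supp (\<chi> a)) \<subseteq> carrier G \<and>
           carrier G \<subseteq> generate G (\<Union>a\<in>carrier G. supp (\<chi> a))"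
proof -
  interpret comm_group G by (rule grp)
  have "partial_char_graph G {(\<one>\<^bsub>G\<^esub>, \<lambda>_. 1)}"
    by (auto simp: partial_char_graph_def supp_def generate.one)
  then have "\<exists>M\<in>{F. partial_char_graph G F}. \<forall>X\<in>{F. partial_char_graph G F}. M \<subseteq> X \<longrightarrow> X = M"
    using partial_char_graph_Union[OF grp] by (intro subset_Zorn_nonempty) auto
  then obtain F where F: "partial_char_graph G F"
    and max: "\<And>F'. partial_char_graph G F' \<Longrightarrow> F \<subseteq> F' \<Longrightarrow> F' = F" by blast
  have dom: "fst ` F = carrier G"
  proof
    show "fst ` F \<subseteq> carrier G" using graph_carrier[OF grp F] by auto
    show "carrier G \<subseteq> fst ` F"
    proof (rule subsetI, rule ccontr)
      fix g assume "g \<in> carrier G" "g \<notin> fst ` F"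
      then obtain F' where "partial_char_graph G F'" "F \<subset> F'"
        using ex_proper_extension[OF grp F] by blast
      then show False using max[of F'] by blast
    qed
  qed
  define \<chi> where "\<chi> a = (THE f. (a, f) \<in> F)" for a
  have chi_eq: "\<chi> a = f" if "(a, f) \<in> F" for a f
    unfolding \<chi>_def using that graph_unique[OF grp F] by blast
  have chi: "(a, \<chi> a) \<in> F" if "a \<in> carrier G" for a
  proof -
    from \<open>a \<in> carrier G\<close> obtain f where "(a, f) \<in> F" unfolding dom[symmetric] by auto
    then show ?thesis using chi_eq by simp
  qed
  have "char_family G \<chi>"
    unfolding char_family_def
  proof (intro conjI ballI allI)
    fix a b i assume "a \<in> carrier G" "b \<in> carrier G"
    then show "\<chi> (a \<otimes>\<^bsub>G\<^esub> b) i = \<chi> a i * \<chi> b i"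
      using chi_eq[OF graph_mult[OF grp F chi chi]] by simp
  qed (use chi graph_finite[OF grp F] graph_root[OF grp F] in blast)+
  moreover have labels: "(\<Union>a\<in>carrier G. supp (\<chi> a)) = (\<Union>(a, f)\<in>F. supp f)"
  proof
    show "(\<Union>a\<in>carrier G. supp (\<chi> a)) \<subseteq> (\<Union>(a, f)\<in>F. supp f)" using chi by blast
    show "(\<Union>(a, f)\<in>F. supp f) \<subseteq> (\<Union>a\<in>carrier G. supp (\<chi> a))"
    proof clarify
      fix x a f assume "(a, f) \<in> F" "x \<in> supp f"
      then show "x \<in> (\<Union>a\<in>carrier G. supp (\<chi> a))"
        using chi_eq graph_carrier[OF grp F] by (intro UN_I[of a]) auto
    qed
  qed
  moreover have "(\<Union>(a, f)\<in>F. supp f) \<subseteq> carrier G" using graph_labels[OF grp F] dom by blast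
  ultimately show ?thesis using graph_generate[OF grp F] dom by (intro exI[of _ \<chi>]) simp
qed

lemma ex_char_family_comm:
  fixes G :: "('a, 'm) monoid_scheme"
  assumes grp: "comm_group G" and unc: "uncountable (carrier G)"
  shows "\<exists>\<chi> :: 'a \<Rightarrow> 'a \<Rightarrow> complex. char_family G \<chi> \<and>
           |carrier G| \<le>o |\<Union>a\<in>carrier G. supp (\<chi> a)|"
  using ex_char_family_generate[OF grp] card_generate_le[OF comm_group.axioms(2)[OF grp] _ _ unc]
  by blast

section \<open>Parities in free groups\<close>

text \<open>The parity of the number of occurrences of \<open>s\<close>, written as \<open>1\<close> or \<open>- 1\<close>. Both
  \<open>s\<close> and its formal inverse count, so cancelling a letter against its inverse changes no parity,
  and the parities depend only on the value of the word in a free group.\<close>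

definition letter_parity :: "('a \<times> bool) list \<Rightarrow> 'a \<Rightarrow> complex" where
  "letter_parity w s = (- 1) ^ length (filter (\<lambda>p. fst p = s) w)"

lemma letter_parity_simps [simp]:
  "letter_parity [] s = 1"
  "letter_parity (p # w) s = (if fst p = s then - letter_parity w s else letter_parity w s)"
  "letter_parity (v @ w) s = letter_parity v s * letter_parity w s"
  by (auto simp: letter_parity_def power_add)

lemma letter_parity_root: "letter_parity w s \<in> unity_roots"
proof -
  have "letter_parity w s ^ 2 = 1" unfolding letter_parity_def by (simp flip: power_mult)
  then show ?thesis unfolding unity_roots_def by (intro CollectI exI[of _ 2]) simp
qed

lemma supp_letter_parity: "supp (letter_parity w) \<subseteq> fst ` set w"
  unfolding supp_def by (induction w) auto

text \<open>The word is reduced from right to left: prefixing a letter to a reduced word either keeps it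
  reduced or cancels its first letter.\<close>

lemma reduce_word:
  fixes G :: "('a, 'm) monoid_scheme"
  assumes grp: "group G" and SG: "S \<subseteq> carrier G" and w: "fst ` set w \<subseteq> S"
  shows "\<exists>v. fst ` set v \<subseteq> S \<and> reduced_word v \<and> word_value G v = word_value G w \<and>
             letter_parity v = letter_parity w"
  using w
proof (induction w)
  case Nil
  then show ?case by (intro exI[of _ "[]"]) (simp add: reduced_word_def)
next
  case (Cons p w)
  interpret group G by (rule grp)
  obtain v where v: "fst ` set v \<subseteq> S" "reduced_word v" "word_value G v = word_value G w"
      "letter_parity v = letter_parity w"
    using Cons by auto
  have p: "fst p \<in> S" "fst p \<in> carrier G" using Cons.prems SG by auto
  show ?case
  proof (cases "\<exists>q u. v = q # u \<and> fst p = fst q \<and> snd p \<noteq> snd q")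
    case True
    then obtain q u where q: "v = q # u" "fst p = fst q" "snd p \<noteq> snd q" by blast
    have uS: "fst ` set u \<subseteq> S" using v(1) q(1) by auto
    have "word_value G (p # w) = word_value G u"
      using q p word_value_closed[OF grp] uS SG unfolding word_value.simps v(3)[symmetric]
      by (cases "snd p") (auto simp: m_assoc[symmetric])
    moreover have "letter_parity u = letter_parity (p # w)"
      using q by (intro ext) (auto simp flip: v(4))
    moreover have "reduced_word u"
      using v(2) q(1) by (auto simp: reduced_word_def successively_Cons)
    ultimately show ?thesis using uS by metis
  next
    case False
    then have "reduced_word (p # v)"
      using v(2) by (cases v) (auto simp: reduced_word_def)
    moreover have "letter_parity (p # v) = letter_parity (p # w)" by (intro ext) (simp add: v(4))
    ultimately show ?thesis using v p by (intro exI[of _ "p # v"]) auto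
  qed
qed

lemma ex_char_family_free:
  fixes G :: "('a, 'm) monoid_scheme"
  assumes grp: "group G" and S: "free_basis G S"
  shows "\<exists>\<chi> :: 'a \<Rightarrow> 'a \<Rightarrow> complex. char_family G \<chi> \<and> S \<subseteq> (\<Union>a\<in>carrier G. supp (\<chi> a))"
proof -
  interpret group G by (rule grp)
  have SG: "S \<subseteq> carrier G" using S unfolding free_basis_def by blast
  let ?red = "\<lambda>g w. fst ` set w \<subseteq> S \<and> reduced_word w \<and> word_value G w = g"
  have ex1: "\<exists>!w. ?red g w" if "g \<in> carrier G" for g
    using S that unfolding free_basis_def by blast
  define nf where "nf g = (THE w. ?red g w)" for g
  have nf: "?red g (nf g)" if "g \<in> carrier G" for g
    unfolding nf_def by (rule theI'[OF ex1[OF that]])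
  define \<chi> where "\<chi> g = letter_parity (nf g)" for g
  have chi: "\<chi> (word_value G w) = letter_parity w" if w: "fst ` set w \<subseteq> S" for w
  proof -
    have wG: "word_value G w \<in> carrier G" using w SG by (intro word_value_closed[OF grp]) blast
    obtain v where v: "?red (word_value G w) v" "letter_parity v = letter_parity w"
      using reduce_word[OF grp SG w] by blast
    then have "nf (word_value G w) = v" using ex1[OF wG] nf[OF wG] by blast
    then show ?thesis using v(2) unfolding \<chi>_def by simp
  qed
  have "char_family G \<chi>"
    unfolding char_family_def
  proof (intro conjI ballI allI)
    fix a b i assume a: "a \<in> carrier G" and b: "b \<in> carrier G"
    have "word_value G (nf a @ nf b) = a \<otimes>\<^bsub>G\<^esub> b" 
      using word_value_append[OF grp, of "nf a" "nf b"] nf[OF a] nf[OF b] SG by auto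
    then have "\<chi> (a \<otimes>\<^bsub>G\<^esub> b) = letter_parity (nf a @ nf b)"
      using chi[of "nf a @ nf b"] nf[OF a] nf[OF b] by auto
    then show "\<chi> (a \<otimes>\<^bsub>G\<^esub> b) i = \<chi> a i * \<chi> b i" by (simp add: \<chi>_def)
  next
    show "finite (supp (\<chi> a))" for a
      unfolding \<chi>_def by (rule finite_subset[OF supp_letter_parity]) simp
    show "\<chi> a i \<in> unity_roots" for a i
      unfolding \<chi>_def by (rule letter_parity_root)
  qed
  moreover have "s \<in> supp (\<chi> s)" if s: "s \<in> S" for s
  proof -
    have "word_value G [(s, True)] = s" using s SG by auto
    then have "\<chi> s = letter_parity [(s, True)]" using chi[of "[(s, True)]"] s by simp
    then show ?thesis by (simp add: supp_def)
  qed
  ultimately show ?thesis using SG by (intro exI[of _ \<chi>]) blast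
qed

section \<open>Partitions with large covering numbers\<close>

lemma char_family_comp:
  assumes "char_family H \<chi>" "h \<in> hom G H"
  shows "char_family G (\<lambda>a. \<chi> (h a))"
  using assms unfolding char_family_def by (simp add: hom_mult hom_in_carrier)

theorem mainTheorem3:
  fixes G :: "('a, 'm) monoid_scheme"
  assumes "group G"
    and "infinite (carrier G)"
    and "comm_group G
       \<or> (\<exists>(H :: 'b monoid) h. comm_group H \<and> h \<in> epi G H \<and> |carrier H| =o |carrier G| )
       \<or> (\<exists>S. free_basis G S \<and> |S| =o |carrier G| )"
  shows "\<exists>A :: nat \<Rightarrow> 'a set.
           (\<forall>n. A n \<noteq> {}) \<and> disjoint_family A \<and> (\<Union>n. A n) = carrier G \<and>
           (\<forall>n. cov G (A n <#>\<^bsub>G\<^esub> set_inv\<^bsub>G\<^esub> (A n)) =o |carrier G| )"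
proof (cases "countable (carrier G)")
  case True
  then show ?thesis using countable_group_partition assms(1,2) by blast
next
  case unc: False
  note partition = partition_of_char_family[OF assms(1) _ unc]
  from assms(3) show ?thesis
  proof (elim disjE exE conjE)
    assume "comm_group G"
    then show ?thesis using ex_char_family_comm[OF _ unc] partition by blast
  next
    fix H :: "'b monoid" and h
    assume H: "comm_group H" and h: "h \<in> epi G H" and card: "|carrier H| =o |carrier G|"
    have "uncountable (carrier H)"
    proof
      assume "countable (carrier H)"
      moreover obtain f where "bij_betw f (carrier G) (carrier H)"
        using ordIso_symmetric[OF card] card_of_ordIso by blast
      ultimately show False using unc countableI_bij2 by blast
    qed
    then obtain \<chi> :: "'b \<Rightarrow> 'b \<Rightarrow> complex"
      where chi: "char_family H \<chi>" "|carrier H| \<le>o |\<Union>b\<in>carrier H. supp (\<chi> b)|"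
      using ex_char_family_comm[OF H] by blast
    have hh: "h \<in> hom G H" "h ` carrier G = carrier H" using h unfolding epi_def by auto
    have "|carrier G| \<le>o |\<Union>a\<in>carrier G. supp (\<chi> (h a))|"
      using ordIso_ordLeq_trans[OF ordIso_symmetric[OF card] chi(2)] by (simp flip: hh(2))
    then show ?thesis by (rule partition[OF char_family_comp[OF chi(1) hh(1)]])
  next
    fix S assume S: "free_basis G S" and card: "|S| =o |carrier G|"
    obtain \<chi> :: "'a \<Rightarrow> 'a \<Rightarrow> complex"
      where chi: "char_family G \<chi>" "S \<subseteq> (\<Union>a\<in>carrier G. supp (\<chi> a))"
      using ex_char_family_free[OF assms(1) S] by blast
    have "|carrier G| \<le>o |\<Union>a\<in>carrier G. supp (\<chi> a)|"
      using ordIso_ordLeq_trans[OF ordIso_symmetric[OF card] card_of_mono1[OF chi(2)]] .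
    then show ?thesis by (rule partition[OF chi(1)])
  qed
qed

end
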